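(* Let $f \colon \mathbb{R}^n \to \mathbb{R}$ be $C^2$. For (Lebesgue-)almost all $\alpha > 0$, gradient descent with constant step size $\alpha$, that is, $x_{t+1} = x_t - \alpha \nabla f(x_t)$, avoids the strict saddles of $f$: the set of initial points $x_0 \in \mathbb{R}^n$ such that $(x_t)_{t\ge0}$ converges to a strict saddle of $f$ has Lebesgue measure zero.
   Context: A strict saddle of a $C^2$ function $f$ is a point where $\nabla f$ is zero and the Hessian $\nabla^2 f$ has at least one negative eigenvalue. *)

theory Defs
  imports "HOL-Analysis.Analysis"
begin

(* Only meaningful where f is differentiable; see gradient_eq. *)
definition gradient :: "('a::real_inner \<Rightarrow> real) \<Rightarrow> 'a \<Rightarrow> 'a" where
  "gradient f x = (THE D. GDERIV f x :> D)"

lemma gradient_eq: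
  assumes "GDERIV f x :> D"
  shows "gradient f x = D"
  unfolding gradient_def
proof (rule the_equality)
  fix E assume "GDERIV f x :> E"
  with assms have "(\<lambda>h. h \<bullet> D) = (\<lambda>h. h \<bullet> E)"
    unfolding gderiv_def by (rule has_derivative_unique)
  then have "\<forall>h. h \<bullet> D = h \<bullet> E"
    by (simp add: fun_eq_iff)
  then show "E = D"
    by (metis vector_eq_ldot vector_eq_rdot)
qed (fact assms)

definition hessian :: "(real^'n \<Rightarrow> real) \<Rightarrow> real^'n \<Rightarrow> real^'n^'n" where
  "hessian f x = jacobian (gradient f) (at x)"

definition C2 :: "(real^'n \<Rightarrow> real) \<Rightarrow> bool" where
  "C2 f \<longleftrightarrow> (\<forall>x. f differentiable (at x)) \<and>
     (\<forall>x. gradient f differentiable (at x)) \<and>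
     continuous_on UNIV (hessian f)"

(* Real eigenvalues suffice: a Hessian of a C2 function is symmetric. *)
definition eigenvalue :: "real^'n^'n \<Rightarrow> real \<Rightarrow> bool" where
  "eigenvalue A c \<longleftrightarrow> (\<exists>v. v \<noteq> 0 \<and> A *v v = c *\<^sub>R v)"

definition strict_saddle :: "(real^'n \<Rightarrow> real) \<Rightarrow> real^'n \<Rightarrow> bool" where
  "strict_saddle f x \<longleftrightarrow> gradient f x = 0 \<and> (\<exists>c<0. eigenvalue (hessian f x) c)"

primrec gradient_descent :: "('a::real_inner \<Rightarrow> real) \<Rightarrow> real \<Rightarrow> 'a \<Rightarrow> nat \<Rightarrow> 'a" where
  "gradient_descent f \<alpha> x0 0 = x0"
| "gradient_descent f \<alpha> x0 (Suc t) =
     gradient_descent f \<alpha> x0 t - \<alpha> *\<^sub>R gradient f (gradient_descent f \<alpha> x0 t)"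

end

theory Submission
  imports Defs
begin

text \<open>
  For fixed \<open>x\<close> the derivative \<open>I - \<alpha> H(x)\<close> of the gradient step is singular for finitely many
  \<open>\<alpha>\<close> only, so by Fubini the step is, for almost every \<open>\<alpha>\<close>, a local diffeomorphism off a null set;
  preimages of null sets under it are then null. By the Lindelof property it remains to find, around each
  strict saddle \<open>s\<close>, a ball in which the set of forever trapped points is null. No centre-stable
  manifold is needed: the symmetric map \<open>A = I - \<alpha> H(s)\<close> has an eigenvector \<open>v\<close> with eigenvalue
  greater than \<open>1\<close>, and for suitable \<open>k > 1\<close> the cone \<open>{d. k \<parallel>d\<parallel> \<le> \<parallel>A d\<parallel>}\<close> contains \<open>v\<close>, is
  preserved by the dynamics of differences of nearby orbits, and expands. Hence no two trapped points
  differ by a multiple of \<open>v\<close>, and the trapped set has infinitely many disjoint translates inside a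
  bounded region.
\<close>

section \<open>Points trapped near an unstable point\<close>

text \<open>Mean value inequality on a ball where \<open>g'\<close> stays close to
  \<open>g' s\<close>. The error is relative to \<open>y - z\<close>, not to the distance from
  \<open>s\<close>, as the comparison of two orbits requires.\<close>

lemma C1_strict_bound:
  fixes g :: "'a::euclidean_space \<Rightarrow> 'a" and g' :: "'a \<Rightarrow> 'a \<Rightarrow>\<^sub>L 'a"
  assumes der: "\<And>x. (g has_derivative g' x) (at x)" and cont: "continuous_on UNIV g'"
    and "\<epsilon> > 0"
  obtains r where "r > 0"
    "\<And>y z. y \<in> cball s r \<Longrightarrow> z \<in> cball s r \<Longrightarrow> norm (g y - g z - g' s (y - z)) \<le> \<epsilon> * norm (y - z)"
proof -
  have "isCont g' s" using cont by (simp add: continuous_on_eq_continuous_at)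
  then obtain d where d: "d > 0" "\<And>x. dist x s < d \<Longrightarrow> dist (g' x) (g' s) < \<epsilon>"
    using \<open>\<epsilon> > 0\<close> unfolding continuous_at_eps_delta by blast
  show ?thesis
  proof (rule that[of "d/2"])
    fix y z assume yz: "y \<in> cball s (d/2)" "z \<in> cball s (d/2)"
    have "norm (g y - g z - g' s (y - z)) \<le> norm (y - z) * \<epsilon>"
    proof (rule differentiable_bound_linearization[where S="cball s (d/2)" and f'="\<lambda>x. blinfun_apply (g' x)"])
      show "z + t *\<^sub>R (y - z) \<in> cball s (d/2)" if "t \<in> {0..1}" for t
        using that yz convex_cball[of s "d/2"] unfolding convex_alt
        by (auto simp: algebra_simps)
      show "(g has_derivative g' x) (at x within cball s (d/2))" for x
        using der by (rule has_derivative_at_withinI)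
      show "onorm (blinfun_apply (g' x) - blinfun_apply (g' s)) \<le> \<epsilon>" if "x \<in> cball s (d/2)" for x
      proof -
        have "norm (g' x - g' s) < \<epsilon>" using d that by (force simp: dist_norm norm_minus_commute)
        then show ?thesis by (simp add: norm_blinfun.rep_eq minus_blinfun.rep_eq fun_diff_def)
      qed
    qed (use d in auto)
    then show "norm (g y - g z - g' s (y - z)) \<le> \<epsilon> * norm (y - z)" by (simp add: mult.commute)
  qed (use d in auto)
qed

text \<open>Eigenvectors for distinct eigenvalues are orthogonal, hence independent. Used for the
  square of \<open>A\<close> and for the Hessian.\<close>

lemma finite_eigenvalues_self_adjoint:
  fixes T :: "'a::euclidean_space \<Rightarrow> 'a"
  assumes sym: "\<And>u v. T u \<bullet> v = u \<bullet> T v"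
  shows "finite {c. \<exists>v. v \<noteq> 0 \<and> T v = c *\<^sub>R v}" (is "finite ?E")
proof -
  define w where "w c = (SOME v. v \<noteq> 0 \<and> T v = c *\<^sub>R v)" for c
  have w: "w c \<noteq> 0" "T (w c) = c *\<^sub>R w c" if "c \<in> ?E" for c
    using someI_ex[of "\<lambda>v. v \<noteq> 0 \<and> T v = c *\<^sub>R v"] that by (auto simp: w_def)
  have orth: "w c \<bullet> w d = 0" if "c \<in> ?E" "d \<in> ?E" "c \<noteq> d" for c d
    using sym[of "w c" "w d"] w[OF that(1)] w[OF that(2)] that(3) by simp
  have "inj_on w ?E" using orth w by (metis (no_types, lifting) inj_onI inner_eq_zero_iff)
  moreover have "0 \<notin> w ` ?E" using w(1) by (metis (no_types, lifting) imageE)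
  then have "independent (w ` ?E)"
    using orth by (intro pairwise_orthogonal_independent) (auto simp: pairwise_image orthogonal_def pairwise_def)
  then have "finite (w ` ?E)" by (rule finiteI_independent)
  ultimately show ?thesis by (simp add: finite_image_iff)
qed

text \<open>The translates by \<open>v / (n + 1)\<close> are disjoint, of equal measure and jointly
  bounded, so their measures form a summable constant sequence.\<close>

lemma negligible_disjoint_translates:
  fixes W :: "'a::euclidean_space set"
  assumes "compact W" and disj: "\<And>x y t. x \<in> W \<Longrightarrow> y \<in> W \<Longrightarrow> x - y = t *\<^sub>R v \<Longrightarrow> t = 0"
  shows "negligible W"
proof -
  define S where "S n = (+) (inverse (Suc n) *\<^sub>R v) ` W" for n
  have W: "W \<in> lmeasurable" using \<open>compact W\<close> by (rule lmeasurable_compact)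
  have "S m \<inter> S n = {}" if "m \<noteq> n" for m n
  proof (rule ccontr)
    assume "S m \<inter> S n \<noteq> {}"
    then obtain x y where xy: "x \<in> W" "y \<in> W"
      "inverse (Suc m) *\<^sub>R v + x = inverse (Suc n) *\<^sub>R v + y"
      by (auto simp: S_def)
    then have "x - y = (inverse (Suc n) - inverse (Suc m)) *\<^sub>R v"
      by (simp add: algebra_simps)
    from disj[OF xy(1,2) this] that show False by simp
  qed
  then have "pairwise (\<lambda>m n. negligible (S m \<inter> S n)) UNIV" by (simp add: pairwise_def)
  moreover have "bounded (\<Union>n. S n)"
  proof -
    obtain B where B: "\<And>x. x \<in> W \<Longrightarrow> norm x \<le> B"
      using compact_imp_bounded[OF \<open>compact W\<close>] by (auto simp: bounded_iff)
    have "norm (inverse (Suc n) *\<^sub>R v + x) \<le> norm v + B" if "x \<in> W" for n x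
    proof -
      have "norm (inverse (Suc n) *\<^sub>R v) \<le> norm v"
        by (simp add: mult_left_le_one_le inverse_le_1_iff)
      then show ?thesis using B[OF that] norm_triangle_le add_mono by blast
    qed
    then show ?thesis unfolding bounded_iff S_def by blast
  qed
  moreover have "S n \<in> lmeasurable" for n unfolding S_def by (rule measurable_translation[OF W])
  ultimately have "summable (\<lambda>n. measure lebesgue (S n))"
    using measure_countable_negligible_Union_bounded sums_summable by blast
  then have "measure lebesgue W = 0" by (simp add: S_def measure_translation summable_const_iff)
  then show ?thesis using W negligible_iff_measure by blast
qed

text \<open>
  By symmetry \<open>\<parallel>A d\<parallel>\<^sup>2 = \<langle>d, A (A d)\<rangle> \<le> \<parallel>d\<parallel> \<parallel>A (A d)\<parallel>\<close>, so \<open>A\<close> preserves the cone. Choosing \<open>k\<^sup>2\<close> outside the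
  finite spectrum of \<open>A\<^sup>2\<close> excludes equality in Cauchy-Schwarz on its boundary; compactness of the unit
  sphere then leaves room for the error \<open>e\<close>.
\<close>
lemma expanding_cone:
  fixes A :: "'a::euclidean_space \<Rightarrow>\<^sub>L 'a"
  assumes sym: "\<And>u v. A u \<bullet> v = u \<bullet> A v"
    and v: "v \<noteq> 0" "A v = \<mu> *\<^sub>R v" "\<mu> > 1"
  obtains k \<epsilon> where "k < \<mu>" "\<epsilon> > 0" "k - \<epsilon> > 1"
    "\<And>d e. k * norm d \<le> norm (A d) \<Longrightarrow> norm e \<le> \<epsilon> * norm d \<Longrightarrow>
       k * norm (A d + e) \<le> norm (A (A d + e))"
proof -
  let ?E = "{c. \<exists>v. v \<noteq> 0 \<and> A (A v) = c *\<^sub>R v}"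
  have "finite ?E"
    by (rule finite_eigenvalues_self_adjoint) (simp add: sym)
  moreover have "infinite ((\<lambda>k. k\<^sup>2) ` {1<..<\<mu>})"
    using v(3) by (subst finite_image_iff) (auto simp: inj_on_def infinite_Ioo power2_eq_iff)
  ultimately obtain k where k: "1 < k" "k < \<mu>" "k\<^sup>2 \<notin> ?E"
    by (metis (no_types, lifting) finite_subset greaterThanLessThan_iff image_subsetI)
  define S where "S = sphere 0 1 \<inter> {d. k \<le> norm (A d)}"
  have "compact S" unfolding S_def
    by (intro compact_Int_closed compact_sphere closed_Collect_le continuous_intros)
  \<comment> \<open>Since \<open>k < \<mu>\<close>, the cone contains \<open>v\<close>; so
    \<open>S\<close> is nonempty and the minimum below is attained.\<close>
  moreover have "(1 / norm v) *\<^sub>R v \<in> S"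
    using k v by (simp add: S_def blinfun.scaleR_right)
  ultimately obtain d0 where d0: "d0 \<in> S"
    "\<And>d. d \<in> S \<Longrightarrow> norm (A (A d0)) - k * norm (A d0) \<le> norm (A (A d)) - k * norm (A d)"
    using continuous_attains_inf[of S "\<lambda>d. norm (A (A d)) - k * norm (A d)"]
    by (force intro!: continuous_intros)
  define \<delta> where "\<delta> = norm (A (A d0)) - k * norm (A d0)"
  \<comment> \<open>Otherwise \<open>norm (A d0) = k\<close> and Cauchy-Schwarz is an equality for
    \<open>d0\<close> and \<open>A (A d0)\<close>, which makes \<open>k\<^sup>2\<close> an
    eigenvalue of the square of \<open>A\<close>.\<close>
  have "\<delta> > 0"
  proof (rule ccontr)
    assume "\<not> \<delta> > 0"
    then have le: "norm (A (A d0)) \<le> k * norm (A d0)" by (simp add: \<delta>_def)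
    have n: "norm d0 = 1" "k \<le> norm (A d0)" using d0 by (auto simp: S_def)
    have sq: "(norm (A d0))\<^sup>2 = d0 \<bullet> A (A d0)" by (simp add: power2_norm_eq_inner sym)
    also have cs: "\<dots> \<le> norm (A (A d0))" using norm_cauchy_schwarz[of d0 "A (A d0)"] n by simp
    finally have "norm (A d0) * norm (A d0) \<le> k * norm (A d0)" using le by (simp add: power2_eq_square)
    then have a: "norm (A d0) = k" using n k by (auto simp: mult_le_cancel_right)
    have in_d0: "d0 \<bullet> A (A d0) = k\<^sup>2" using sq a by simp
    moreover have "norm (A (A d0)) = k\<^sup>2"
      using le cs unfolding in_d0 a by (simp add: power2_eq_square)
    ultimately have "A (A d0) = k\<^sup>2 *\<^sub>R d0"
      using norm_cauchy_schwarz_eq[of d0 "A (A d0)"] n by simp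
    moreover have "d0 \<noteq> 0" using n by auto
    ultimately show False using k(3) by auto
  qed
  have h: "\<delta> * norm d \<le> norm (A (A d)) - k * norm (A d)" if "k * norm d \<le> norm (A d)" for d
  proof (cases "d = 0")
    case False
    have "(1 / norm d) *\<^sub>R d \<in> S"
      using False that by (simp add: S_def blinfun.scaleR_right field_simps)
    from d0(2)[OF this] False show ?thesis
      by (simp add: \<delta>_def blinfun.scaleR_right field_simps)
  qed simp
  \<comment> \<open>The first bound keeps \<open>k - \<epsilon> > 1\<close>; the second makes the
    total loss \<open>(norm A + k) * norm e\<close> at most
    \<open>\<delta> * norm d\<close>.\<close>
  define \<epsilon> where "\<epsilon> = min ((k - 1) / 2) (\<delta> / (norm A + k))"
  have pos: "norm A + k > 0" using k by (simp add: add_nonneg_pos)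
  show ?thesis
  proof (rule that[of k \<epsilon>])
    have "\<epsilon> \<le> (k - 1) / 2" unfolding \<epsilon>_def by (rule min.cobounded1)
    with k show "k - \<epsilon> > 1" by (simp add: field_simps)
    show "\<epsilon> > 0" using k pos \<open>\<delta> > 0\<close> by (simp add: \<epsilon>_def)
    fix d e :: 'a assume d: "k * norm d \<le> norm (A d)" and e: "norm e \<le> \<epsilon> * norm d"
    have "\<epsilon> \<le> \<delta> / (norm A + k)" unfolding \<epsilon>_def by (rule min.cobounded2)
    then have "(norm A + k) * \<epsilon> \<le> \<delta>" using pos by (simp add: field_simps)
    then have "(norm A + k) * \<epsilon> * norm d \<le> \<delta> * norm d" by (rule mult_right_mono) simp
    moreover have "(norm A + k) * norm e \<le> (norm A + k) * (\<epsilon> * norm d)"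
      using e pos by (intro mult_left_mono) auto
    ultimately have "norm A * norm e + k * norm e \<le> norm (A (A d)) - k * norm (A d)"
      using h[OF d] by (simp add: algebra_simps)
    moreover have "norm (A (A d)) - norm A * norm e \<le> norm (A (A d + e))"
      using norm_blinfun[of A e] norm_diff_ineq[of "A (A d)" "A e"] by (simp add: blinfun.add_right)
    moreover have "k * norm (A d + e) \<le> k * (norm (A d) + norm e)"
      using k by (intro mult_left_mono norm_triangle_ineq) auto
    ultimately show "k * norm (A d + e) \<le> norm (A (A d + e))" by (simp add: algebra_simps)
  qed (use k in auto)
qed

text \<open>Two distinct trapped points differing by a multiple of \<open>v\<close> would have
  orbits separating at rate \<open>k - \<epsilon> > 1\<close>, beyond the diameter
  \<open>2 * r\<close>. Hence \<open>negligible_disjoint_translates\<close> applies.\<close>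

lemma negligible_trapped:
  fixes g :: "'a::euclidean_space \<Rightarrow> 'a" and g' :: "'a \<Rightarrow> 'a \<Rightarrow>\<^sub>L 'a"
  assumes der: "\<And>x. (g has_derivative g' x) (at x)" and cont: "continuous_on UNIV g'"
    and sym: "\<And>u v. g' s u \<bullet> v = u \<bullet> g' s v"
    and v: "v \<noteq> 0" "g' s v = \<mu> *\<^sub>R v" "\<mu> > 1"
  obtains r where "r > 0" "negligible {x. \<forall>n. (g ^^ n) x \<in> cball s r}"
proof -
  obtain k \<epsilon> where k: "k < \<mu>" "\<epsilon> > 0" "k - \<epsilon> > 1"
    and cone: "\<And>d e. k * norm d \<le> norm (g' s d) \<Longrightarrow> norm e \<le> \<epsilon> * norm d \<Longrightarrow>
       k * norm (g' s d + e) \<le> norm (g' s (g' s d + e))"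
    using expanding_cone[OF sym v] by blast
  obtain r where r: "r > 0"
    "\<And>y z. y \<in> cball s r \<Longrightarrow> z \<in> cball s r \<Longrightarrow> norm (g y - g z - g' s (y - z)) \<le> \<epsilon> * norm (y - z)"
    using C1_strict_bound[OF der cont \<open>\<epsilon> > 0\<close>] by blast
  define W where "W = {x. \<forall>n. (g ^^ n) x \<in> cball s r}"
  have gcont: "continuous_on UNIV g"
    using der has_derivative_continuous continuous_at_imp_continuous_on by blast
  have "continuous_on UNIV (g ^^ n)" for n
    by (induction n) (auto intro: continuous_on_compose2[OF gcont])
  then have "closed ((g ^^ n) -` cball s r)" for n
    by (intro closed_vimage) auto
  moreover have Weq: "W = (\<Inter>n. (g ^^ n) -` cball s r)" by (auto simp: W_def)
  ultimately have "closed W" by auto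
  moreover have "W \<subseteq> cball s r" unfolding W_def by (metis (mono_tags, lifting) funpow_0 mem_Collect_eq subsetI)
  ultimately have "compact W" using bounded_cball bounded_subset compact_eq_bounded_closed by blast
  then have "negligible W"
  proof (rule negligible_disjoint_translates)
    fix x y t assume xy: "x \<in> W" "y \<in> W" "x - y = t *\<^sub>R v"
    define D where "D n = (g ^^ n) x - (g ^^ n) y" for n
    \<comment> \<open>Both claims go through one induction: \<open>D 0\<close> is in the cone as a
      multiple of \<open>v\<close>, and being in the cone gives a stretch by \<open>k\<close>, of
      which the linearization error takes away at most \<open>\<epsilon>\<close>.\<close>
    have D: "k * norm (D n) \<le> norm (g' s (D n)) \<and> (k - \<epsilon>) ^ n * norm (D 0) \<le> norm (D n)" for n
    proof (induction n)
      case 0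
      have "k * \<bar>t\<bar> \<le> \<bar>\<mu> * t\<bar>" using k v(3) by (simp add: abs_mult mult_right_mono)
      then show ?case using xy v by (simp add: D_def blinfun.scaleR_right algebra_simps)
    next
      case (Suc n)
      define e where "e = D (Suc n) - g' s (D n)"
      have e: "norm e \<le> \<epsilon> * norm (D n)"
        using r(2)[of "(g ^^ n) x" "(g ^^ n) y"] xy by (simp add: W_def D_def e_def)
      have Deq: "D (Suc n) = g' s (D n) + e" by (simp add: e_def)
      have "(k - \<epsilon>) * norm (D n) \<le> norm (D (Suc n))"
        using Suc e norm_diff_ineq[of "g' s (D n)" e] by (simp add: Deq algebra_simps)
      moreover have "(k - \<epsilon>) * ((k - \<epsilon>) ^ n * norm (D 0)) \<le> (k - \<epsilon>) * norm (D n)"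
        using Suc k by (intro mult_left_mono) auto
      ultimately show ?case using cone[OF _ e] Suc by (simp add: Deq mult.assoc)
    qed
    have bound: "norm (D n) \<le> 2 * r" for n
    proof -
      have "dist s ((g ^^ n) x) \<le> r" "dist s ((g ^^ n) y) \<le> r" using xy by (auto simp: W_def)
      then have "dist ((g ^^ n) x) ((g ^^ n) y) \<le> 2 * r"
        using dist_triangle3[of "(g ^^ n) x" "(g ^^ n) y" s] by linarith
      then show ?thesis by (simp add: D_def dist_norm)
    qed
    show "t = 0"
    proof (rule ccontr)
      assume "t \<noteq> 0"
      then have "norm (D 0) > 0" using xy v by (simp add: D_def)
      moreover obtain n where "2 * r / norm (D 0) < (k - \<epsilon>) ^ n"
        using real_arch_pow k by blast
      ultimately show False using D[of n] bound[of n] by (simp add: field_simps)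
    qed
  qed
  with r that show ?thesis by (simp add: W_def)
qed

section \<open>From single balls to all unstable limits\<close>

text \<open>Countably many of the balls cover \<open>U\<close>. An orbit converging into
  \<open>U\<close> eventually stays in one of them, so its start lies in an iterated preimage of a
  null trapped set.\<close>

lemma negligible_converging_to_unstable:
  fixes g :: "'a::euclidean_space \<Rightarrow> 'a" and g' :: "'a \<Rightarrow> 'a \<Rightarrow>\<^sub>L 'a"
  assumes der: "\<And>x. (g has_derivative g' x) (at x)" and cont: "continuous_on UNIV g'"
    and crit: "negligible {x. \<not> inj (g' x)}"
    and U: "\<And>s. s \<in> U \<Longrightarrow> (\<forall>u v. g' s u \<bullet> v = u \<bullet> g' s v) \<and> (\<exists>v \<mu>. v \<noteq> 0 \<and> g' s v = \<mu> *\<^sub>R v \<and> \<mu> > 1)"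
  shows "negligible {x. \<exists>s\<in>U. (\<lambda>n. (g ^^ n) x) \<longlonglongrightarrow> s}"
proof -
  have "\<exists>r>0. negligible {x. \<forall>n. (g ^^ n) x \<in> cball s r}" if "s \<in> U" for s
    using U[OF that] negligible_trapped[OF der cont, of s] by metis
  then obtain R where R: "\<And>s. s \<in> U \<Longrightarrow> R s > 0"
      "\<And>s. s \<in> U \<Longrightarrow> negligible {x. \<forall>n. (g ^^ n) x \<in> cball s (R s)}"
    by metis
  obtain F where F: "F \<subseteq> (\<lambda>s. ball s (R s)) ` U" "countable F" "\<Union>F = (\<Union>s\<in>U. ball s (R s))"
    using Lindelof[of "(\<lambda>s. ball s (R s)) ` U"] by auto
  \<comment> \<open>Where \<open>g' x\<close> is injective, null sets pull back to null sets; the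
    remaining points are null by \<open>crit\<close>.\<close>
  have vim: "negligible (g -` N)" if "negligible N" for N
  proof -
    have "negligible {x \<in> {x. inj (g' x)}. g x \<in> N}"
      by (rule negligible_differentiable_vimage[OF that, where f'="\<lambda>x. blinfun_apply (g' x)"])
         (auto intro: has_derivative_at_withinI der)
    then show ?thesis
      by (rule negligible_subset[OF negligible_Un[OF _ crit]]) auto
  qed
  have vimn: "negligible ((g ^^ n) -` N)" if "negligible N" for n N
    using that by (induction n arbitrary: N) (simp_all add: vim flip: vimage_comp)
  let ?W = "\<lambda>B. {x. \<forall>m. (g ^^ m) x \<in> B}"
  have "negligible (?W B)" if "B \<in> F" for B
  proof -
    obtain s where "s \<in> U" "B = ball s (R s)" using \<open>B \<in> F\<close> F(1) by blast
    with R(2)[OF \<open>s \<in> U\<close>] show ?thesis by (elim negligible_subset) (auto simp: less_imp_le)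
  qed
  then have "negligible (\<Union>((\<lambda>(n, B). (g ^^ n) -` ?W B) ` (UNIV \<times> F)))"
    using F(2) vimn by (intro negligible_countable_Union) (auto simp del: vimage_Collect_eq)
  then show ?thesis
  proof (rule negligible_subset, safe)
    fix x s assume s: "s \<in> U" and lim: "(\<lambda>n. (g ^^ n) x) \<longlonglongrightarrow> s"
    have "s \<in> \<Union>F" unfolding F(3) using s R(1)[OF s] by force
    then obtain B where B: "B \<in> F" "s \<in> B" by blast
    then have "open B" using F(1) by auto
    from topological_tendstoD[OF lim this B(2)] obtain N where N: "\<And>n. n \<ge> N \<Longrightarrow> (g ^^ n) x \<in> B"
      by (auto simp: eventually_sequentially)
    \<comment> \<open>From time \<open>N\<close> on the orbit never leaves \<open>B\<close>, so the
      \<open>N\<close>-th iterate is itself trapped.\<close>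
    have "x \<in> (g ^^ N) -` ?W B"
      using N by (auto simp flip: funpow_add[THEN fun_cong, unfolded o_apply])
    with B show "x \<in> (\<Union>((\<lambda>(n, B). (g ^^ n) -` ?W B) ` (UNIV \<times> F)))" by auto
  qed
qed

section \<open>Symmetry of the second derivative\<close>

text \<open>The mean value theorem is used twice, along \<open>u\<close> and then along
  \<open>v\<close>: the second difference is \<open>p t - p 0\<close>, and \<open>q a\<close> is an
  increment of \<open>w\<close>.\<close>

lemma second_difference_mean_value:
  fixes f :: "'a::real_inner \<Rightarrow> real"
  assumes f: "\<And>x. (f has_derivative (\<lambda>h. h \<bullet> G x)) (at x)"
    and G: "\<And>x. (G has_derivative H x) (at x)" and "t > 0"
  obtains a b where "a \<in> {0..t}" "b \<in> {0..t}"
    "f (x + t *\<^sub>R u + t *\<^sub>R v) - f (x + t *\<^sub>R u) - f (x + t *\<^sub>R v) + f x = t\<^sup>2 * (u \<bullet> H (x + a *\<^sub>R u + b *\<^sub>R v) v)"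
proof -
  interpret bounded_linear "H y" for y using G by (rule has_derivative_bounded_linear)
  define p where "p a = f (x + a *\<^sub>R u + t *\<^sub>R v) - f (x + a *\<^sub>R u)" for a
  define q where "q a = u \<bullet> (G (x + a *\<^sub>R u + t *\<^sub>R v) - G (x + a *\<^sub>R u))" for a
  have "(p has_real_derivative q a) (at a)" for a
    unfolding p_def has_field_derivative_def
    by (rule has_derivative_eq_rhs, (rule derivative_eq_intros has_derivative_compose[OF _ f] refl)+)
       (auto simp: q_def inner_diff_right algebra_simps fun_eq_iff)
  then obtain a where a: "0 < a" "a < t" "p t - p 0 = (t - 0) * q a"
    using MVT2[of 0 t p q] \<open>t > 0\<close> by blast
  define w where "w b = u \<bullet> G (x + a *\<^sub>R u + b *\<^sub>R v)" for b
  have "(w has_real_derivative u \<bullet> H (x + a *\<^sub>R u + b *\<^sub>R v) v) (at b)" for b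
    unfolding w_def has_field_derivative_def
    by (rule has_derivative_eq_rhs, (rule derivative_eq_intros has_derivative_compose[OF _ G] refl)+)
       (auto simp: scaleR fun_eq_iff)
  then obtain b where b: "0 < b" "b < t" "w t - w 0 = (t - 0) * (u \<bullet> H (x + a *\<^sub>R u + b *\<^sub>R v) v)"
    using MVT2[of 0 t w "\<lambda>b. u \<bullet> H (x + a *\<^sub>R u + b *\<^sub>R v) v"] \<open>t > 0\<close> by blast
  have "q a = w t - w 0" by (simp add: q_def w_def inner_diff_right)
  with a b show ?thesis
    by (intro that[of a b]) (auto simp: p_def power2_eq_square)
qed

text \<open>The second difference is symmetric in \<open>u\<close> and \<open>v\<close>; divided by
  \<open>t\<^sup>2\<close> it tends to \<open>u \<bullet> H x v\<close>.\<close>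

lemma second_derivative_symmetric:
  fixes f :: "'a::real_inner \<Rightarrow> real" and H :: "'a \<Rightarrow> 'a \<Rightarrow>\<^sub>L 'a"
  assumes f: "\<And>x. (f has_derivative (\<lambda>h. h \<bullet> G x)) (at x)"
    and G: "\<And>x. (G has_derivative H x) (at x)" and cont: "isCont H x"
  shows "H x u \<bullet> v = u \<bullet> H x v"
proof -
  \<comment> \<open>The intermediate points are known only up to bounds; squeezing and continuity of
    \<open>H\<close> at \<open>x\<close> suffice.\<close>
  have lim: "(\<lambda>n. u \<bullet> H (x + a n *\<^sub>R u + b n *\<^sub>R v) v) \<longlonglongrightarrow> u \<bullet> H x v"
    if a: "\<And>n. a n \<in> {0..inverse (real (Suc n))}" and b: "\<And>n. b n \<in> {0..inverse (real (Suc n))}" for a b u v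
  proof -
    have "a \<longlonglongrightarrow> 0"
      by (rule tendsto_sandwich[OF _ _ tendsto_const LIMSEQ_inverse_real_of_nat]) (use a in auto)
    moreover have "b \<longlonglongrightarrow> 0"
      by (rule tendsto_sandwich[OF _ _ tendsto_const LIMSEQ_inverse_real_of_nat]) (use b in auto)
    ultimately have "(\<lambda>n. x + a n *\<^sub>R u + b n *\<^sub>R v) \<longlonglongrightarrow> x + 0 *\<^sub>R u + 0 *\<^sub>R v"
      by (intro tendsto_intros)
    then have "(\<lambda>n. H (x + a n *\<^sub>R u + b n *\<^sub>R v)) \<longlonglongrightarrow> H x"
      by (intro isCont_tendsto_compose[OF cont]) simp
    then show ?thesis by (intro tendsto_intros)
  qed
  define D where "D u v n = f (x + inverse (real (Suc n)) *\<^sub>R u + inverse (real (Suc n)) *\<^sub>R v)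
      - f (x + inverse (real (Suc n)) *\<^sub>R u) - f (x + inverse (real (Suc n)) *\<^sub>R v) + f x" for u v n
  have lim_D: "(\<lambda>n. D u v n / (inverse (real (Suc n)))\<^sup>2) \<longlonglongrightarrow> u \<bullet> H x v" for u v
  proof -
    have "\<exists>a b. a \<in> {0..inverse (real (Suc n))} \<and> b \<in> {0..inverse (real (Suc n))} \<and>
        D u v n = (inverse (real (Suc n)))\<^sup>2 * (u \<bullet> H (x + a *\<^sub>R u + b *\<^sub>R v) v)" for n
      by (rule second_difference_mean_value[OF f G, of "inverse (real (Suc n))" x u v]) (auto simp: D_def)
    then obtain a b where ab: "\<And>n. a n \<in> {0..inverse (real (Suc n))}" "\<And>n. b n \<in> {0..inverse (real (Suc n))}"
        "\<And>n. D u v n = (inverse (real (Suc n)))\<^sup>2 * (u \<bullet> H (x + a n *\<^sub>R u + b n *\<^sub>R v) v)"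
      by metis
    show ?thesis using lim[of a b u v, OF ab(1,2)] unfolding ab(3) by simp
  qed
  have "D u v n = D v u n" for n by (simp add: D_def add_ac)
  then have "v \<bullet> H x u = u \<bullet> H x v"
    using LIMSEQ_unique[OF lim_D[of v u]] lim_D[of u v] by simp
  then show ?thesis by (simp add: inner_commute)
qed

section \<open>Singular derivatives for almost every step size\<close>

text \<open>Fubini for null sets: all slices in one direction are countable, hence null, so almost
  all slices in the other are null.\<close>

lemma AE_negligible_slices:
  fixes Z :: "('a::euclidean_space \<times> 'b::euclidean_space) set"
  assumes "closed Z" and "\<And>y. countable {x. (x, y) \<in> Z}"
  shows "AE x in lebesgue. negligible {y. (x, y) \<in> Z}"
proof -
  have slice: "AE x in lborel. (x, y) \<notin> Z" for y
    using AE_not_in[OF countable_imp_null_set_lborel[OF assms(2)[of y]]] by simp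
  have "AE y in lborel. AE x in lborel. (x, y) \<notin> Z"
    by (rule AE_I2) (rule slice)
  \<comment> \<open>Exchanging the two quantifiers requires measurability in the product, which
    closedness of \<open>Z\<close> provides.\<close>
  moreover have "{z \<in> space (lborel \<Otimes>\<^sub>M lborel). (fst z, snd z) \<notin> Z} \<in> sets (lborel \<Otimes>\<^sub>M lborel)"
    unfolding lborel_prod using \<open>closed Z\<close> by (simp add: open_Compl flip: Compl_eq)
  ultimately have "AE x in lborel. AE y in lborel. (x, y) \<notin> Z"
    using lborel_pair.AE_commute[of "\<lambda>x y. (x, y) \<notin> Z"] by blast
  then have "AE x in lebesgue. AE y in lebesgue. (x, y) \<notin> Z"
    by (simp add: AE_completion_iff)
  then show ?thesis
  proof eventually_elim
    case (elim x)
    then show ?case by (simp add: completion.AE_iff_null_sets negligible_iff_null_sets)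
  qed
qed

text \<open>Singularity at \<open>x\<close> forces \<open>inverse \<alpha>\<close> to be an
  eigenvalue of \<open>H x\<close>, so each \<open>x\<close> has only finitely many bad
  \<open>\<alpha>\<close>.\<close>

lemma AE_negligible_critical_points:
  fixes H :: "'a::euclidean_space \<Rightarrow> 'a \<Rightarrow>\<^sub>L 'a"
  assumes cont: "continuous_on UNIV H" and sym: "\<And>x u v. H x u \<bullet> v = u \<bullet> H x v"
  shows "AE \<alpha> in lebesgue. negligible {x. \<not> inj (id_blinfun - \<alpha> *\<^sub>R H x)}"
proof -
  \<comment> \<open>Kernel vectors are normalised so that \<open>Z\<close> is the projection of a
    closed set along a compact sphere, hence closed.\<close>
  define Z where "Z = {p. \<exists>v. v \<in> sphere 0 1 \<and> (v, p) \<in> {(v, \<alpha>, x). v = \<alpha> *\<^sub>R H x v}}"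
  have inj_iff: "inj (id_blinfun - \<alpha> *\<^sub>R H x) \<longleftrightarrow> (\<alpha>, x) \<notin> Z" for \<alpha> x
  proof -
    have "inj (id_blinfun - \<alpha> *\<^sub>R H x) \<longleftrightarrow> (\<forall>v. v = \<alpha> *\<^sub>R H x v \<longrightarrow> v = 0)"
      by (subst linear_injective_0)
         (auto simp: blinfun.diff_left blinfun.scaleR_left intro!: bounded_linear.linear blinfun.bounded_linear_right)
    also have "\<dots> \<longleftrightarrow> (\<alpha>, x) \<notin> Z"
    proof
      assume *: "(\<alpha>, x) \<notin> Z"
      show "\<forall>v. v = \<alpha> *\<^sub>R H x v \<longrightarrow> v = 0"
      proof (intro allI impI, rule ccontr)
        fix v assume v: "v = \<alpha> *\<^sub>R H x v" "v \<noteq> 0"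
        let ?w = "inverse (norm v) *\<^sub>R v"
        have "\<alpha> *\<^sub>R H x ?w = inverse (norm v) *\<^sub>R (\<alpha> *\<^sub>R H x v)"
          by (simp add: blinfun.scaleR_right mult.commute)
        then have "?w = \<alpha> *\<^sub>R H x ?w" using v(1) by simp
        with v(2) * show False by (auto simp: Z_def dest: spec[of _ ?w])
      qed
    qed (force simp: Z_def)
    finally show ?thesis .
  qed
  have "continuous_on UNIV (\<lambda>p. H (snd (snd p)))"
    by (rule continuous_on_compose2[OF cont]) (auto intro!: continuous_intros)
  then have "closed {p. fst p = fst (snd p) *\<^sub>R H (snd (snd p)) (fst p)}"
    by (intro closed_Collect_eq continuous_intros)
  then have "closed Z" unfolding Z_def
    by (intro closed_compact_projection compact_sphere) (simp add: case_prod_unfold)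
  moreover have "countable {\<alpha>. (\<alpha>, x) \<in> Z}" for x
  proof (rule countable_subset)
    show "{\<alpha>. (\<alpha>, x) \<in> Z} \<subseteq> inverse ` {c. \<exists>v. v \<noteq> 0 \<and> H x v = c *\<^sub>R v}"
    proof safe
      fix \<alpha> assume "(\<alpha>, x) \<in> Z"
      then obtain v where v: "norm v = 1" "v = \<alpha> *\<^sub>R H x v" by (auto simp: Z_def)
      then have "\<alpha> \<noteq> 0" "v \<noteq> 0" by auto
      then have "H x v = inverse \<alpha> *\<^sub>R v" using v(2) by (metis scaleR_scaleR left_inverse scaleR_one)
      with \<open>v \<noteq> 0\<close> show "\<alpha> \<in> inverse ` {c. \<exists>v. v \<noteq> 0 \<and> H x v = c *\<^sub>R v}"
        by (intro image_eqI[of _ _ "inverse \<alpha>"]) auto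
    qed
    show "countable (inverse ` {c. \<exists>v. v \<noteq> 0 \<and> H x v = c *\<^sub>R v})"
      by (intro countable_image countable_finite finite_eigenvalues_self_adjoint sym)
  qed
  ultimately show ?thesis using AE_negligible_slices[of Z] by (simp add: inj_iff)
qed

section \<open>Gradient descent for a C2 function\<close>

text \<open>The adjoint of the derivative, taken at \<open>1\<close>, is its Riesz vector; this is
  what the definite description in \<open>gradient\<close> picks.\<close>

lemma gradient_has_derivative:
  fixes f :: "'a::euclidean_space \<Rightarrow> real"
  assumes "f differentiable at x"
  shows "(f has_derivative (\<lambda>h. h \<bullet> gradient f x)) (at x)"
proof -
  obtain D where D: "(f has_derivative D) (at x)" using assms by (auto simp: differentiable_def)
  have "D = (\<lambda>h. h \<bullet> adjoint D 1)"
    using adjoint_works[OF has_derivative_linear[OF D], of _ 1] by (simp add: fun_eq_iff)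
  with D have "GDERIV f x :> adjoint D 1" by (simp add: gderiv_def)
  with gradient_eq[OF this] show ?thesis by (simp add: gderiv_def)
qed

lemma gradient_descent_eq_funpow:
  "gradient_descent f \<alpha> x0 n = ((\<lambda>x. x - \<alpha> *\<^sub>R gradient f x) ^^ n) x0"
  by (induction n) auto

text \<open>Operator-valued form of the Hessian, since the lemmas above ask for continuity in
  operator norm.\<close>

definition hessian_blinfun :: "(real^'n \<Rightarrow> real) \<Rightarrow> real^'n \<Rightarrow> (real^'n) \<Rightarrow>\<^sub>L (real^'n)" where
  "hessian_blinfun f x = Blinfun ((*v) (hessian f x))"

lemma hessian_blinfun_apply: "blinfun_apply (hessian_blinfun f x) = (*v) (hessian f x)"
  unfolding hessian_blinfun_def
  by (rule bounded_linear_Blinfun_apply) (rule matrix_vector_mul_bounded_linear)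

lemma C2_gradient_derivative:
  fixes f :: "real^'n \<Rightarrow> real"
  assumes "C2 f"
  shows "(gradient f has_derivative hessian_blinfun f x) (at x)"
  using assms jacobian_works[of "gradient f" "at x"] unfolding C2_def hessian_blinfun_apply hessian_def by simp

text \<open>In finite dimension, operator-norm continuity can be tested on basis vectors.\<close>

lemma C2_continuous_hessian:
  fixes f :: "real^'n \<Rightarrow> real"
  assumes "C2 f"
  shows "continuous_on UNIV (hessian_blinfun f)"
proof (rule continuous_on_blinfun_componentwise)
  fix i :: "real^'n"
  have "continuous_on UNIV (hessian f)" using assms by (simp add: C2_def)
  then show "continuous_on UNIV (\<lambda>x. hessian_blinfun f x i)"
    unfolding hessian_blinfun_apply matrix_vector_mult_def by (intro continuous_intros)
qed

theorem theorem3p1: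
  fixes f :: "real^'n \<Rightarrow> real"
  assumes "C2 f"
  shows "AE \<alpha> in lebesgue. \<alpha> > 0 \<longrightarrow>
    {x0. \<exists>s. strict_saddle f s \<and> gradient_descent f \<alpha> x0 \<longlonglongrightarrow> s} \<in> null_sets lebesgue"
proof -
  let ?H = "hessian_blinfun f"
  have f: "(f has_derivative (\<lambda>h. h \<bullet> gradient f x)) (at x)" for x
    using \<open>C2 f\<close> by (simp add: C2_def gradient_has_derivative)
  note G = C2_gradient_derivative[OF \<open>C2 f\<close>]
  note cont = C2_continuous_hessian[OF \<open>C2 f\<close>]
  have sym: "?H x u \<bullet> v = u \<bullet> ?H x v" for x u v
    by (rule second_derivative_symmetric[OF f G]) (use cont in \<open>simp add: continuous_on_eq_continuous_at\<close>)
  from AE_negligible_critical_points[OF cont sym] show ?thesis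
  proof eventually_elim
    case (elim \<alpha>)
    show ?case
    proof
      assume "\<alpha> > 0"
      have "negligible {x. \<exists>s\<in>{s. strict_saddle f s}. (\<lambda>n. ((\<lambda>x. x - \<alpha> *\<^sub>R gradient f x) ^^ n) x) \<longlonglongrightarrow> s}"
      proof (rule negligible_converging_to_unstable[where g'="\<lambda>x. id_blinfun - \<alpha> *\<^sub>R ?H x"])
        show "((\<lambda>x. x - \<alpha> *\<^sub>R gradient f x) has_derivative (id_blinfun - \<alpha> *\<^sub>R ?H x)) (at x)" for x
          by (rule has_derivative_eq_rhs, (rule derivative_intros G)+)
             (simp add: fun_eq_iff blinfun.diff_left blinfun.scaleR_left)
        show "continuous_on UNIV (\<lambda>x. id_blinfun - \<alpha> *\<^sub>R ?H x)"
          by (intro continuous_intros cont)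
        fix s assume "s \<in> {s. strict_saddle f s}"
        then obtain c v where "c < 0" "v \<noteq> 0" "?H s v = c *\<^sub>R v"
          by (auto simp: strict_saddle_def eigenvalue_def hessian_blinfun_apply)
        \<comment> \<open>A negative eigenvalue \<open>c\<close> of the Hessian becomes the
          expanding eigenvalue \<open>1 - \<alpha> * c\<close> of the step, because
          \<open>\<alpha> > 0\<close>.\<close>
        then have "v \<noteq> 0 \<and> (id_blinfun - \<alpha> *\<^sub>R ?H s) v = (1 - \<alpha> * c) *\<^sub>R v \<and> 1 - \<alpha> * c > 1"
          using \<open>\<alpha> > 0\<close> by (simp add: blinfun.diff_left blinfun.scaleR_left algebra_simps mult_pos_neg)
        moreover have "(id_blinfun - \<alpha> *\<^sub>R ?H s) u \<bullet> w = u \<bullet> (id_blinfun - \<alpha> *\<^sub>R ?H s) w" for u w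
          using sym[of s u w] by (simp add: blinfun.diff_left blinfun.scaleR_left inner_diff)
        ultimately show "(\<forall>u w. (id_blinfun - \<alpha> *\<^sub>R ?H s) u \<bullet> w = u \<bullet> (id_blinfun - \<alpha> *\<^sub>R ?H s) w) \<and>
            (\<exists>v \<mu>. v \<noteq> 0 \<and> (id_blinfun - \<alpha> *\<^sub>R ?H s) v = \<mu> *\<^sub>R v \<and> \<mu> > 1)"
          by blast
      qed (fact elim)
      then show "{x0. \<exists>s. strict_saddle f s \<and> gradient_descent f \<alpha> x0 \<longlonglongrightarrow> s} \<in> null_sets lebesgue"
        by (simp add: negligible_iff_null_sets flip: gradient_descent_eq_funpow)
    qed
  qed
qed

end
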